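(* For all integers $j,k\ge0$, $$\begin{aligned}A_{j,k,2}={}&2k(k-1)\,D_{2j,k}\\&+4(k-1)(4j-4k+5)\,D_{2j,k-1}\\&+16(j-k+2)(2j-2k+3)\,D_{2j,k-2}.\end{aligned}$$
   Context: For $n\ge1$, $\mathfrak B_n$ is the hyperoctahedral group of signed permutations: words $\pi=\pi_1\cdots\pi_n$ of nonzero integers such that $|\pi_1|,\dots,|\pi_n|$ is a permutation of $[n]=\{1,\dots,n\}$, with $\pi(i)=\pi_i$, $\pi(-i)=-\pi(i)$. $\mathcal I_n^B$ is the set of $\pi\in\mathfrak B_n$ with $\pi^2=\mathrm{id}$ (for $n=0$, a single empty involution). With $\pi_0=0$ and the usual order on $\mathbb Z$, $\operatorname{des}^B(\pi)=\#\{0\le i\le n-1:\pi_i>\pi_{i+1}\}$, and $\operatorname{fix}_B(\pi)=\#\{i\in[n]:|\pi(i)|=i\}$. Let $J_{2j}^B(t)=\sum t^{\operatorname{des}^B(\pi)}$ over $\pi\in\mathcal I_{2j}^B$ with $\operatorname{fix}_B(\pi)=0$, and let $P_j(x)=\sum_{s=0}^jD_{2j,s}x^s$ be the unique polynomial with $J_{2j}^B(t)=(1+t)^{2j}P_j\!\left(\frac{t}{(1+t)^2}\right)$ (it exists because $J_{2j}^B$ is palindromic with center $j$). Convention: $D_{2j,s}=0$ for $s<0$ or $s>j$. The numbers $A_{j,k,r}$ are the coefficients in $A_{j,r}(x)=\sum_kA_{j,k,r}x^k$, where $$\sum_{r\ge0}A_{j,r}(x)W^r=(1+4xW)^{2j}\,P_j\!\left(\frac{x(1+2W+4xW^2)}{(1+4xW)^2}\right).$$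 *)

theory Defs
  imports
    "HOL-Computational_Algebra.Computational_Algebra"
    "HOL-Combinatorics.Multiset_Permutations"
begin

text \<open>The word \<open>\<pi>\<^sub>1 \<cdots> \<pi>\<^sub>n\<close> is the list \<open>[\<pi>\<^sub>1, \<dots>, \<pi>\<^sub>n]\<close>, so that \<open>\<pi>\<^sub>i = (0 # \<pi>) ! i\<close> for
  \<open>0 \<le> i \<le> n\<close>, including \<open>\<pi>\<^sub>0 = 0\<close>.\<close>

definition signed_perms :: "nat \<Rightarrow> int list set" where
  "signed_perms n = {w. map abs w \<in> permutations_of_set {1..int n}}"

definition sp_apply :: "int list \<Rightarrow> int \<Rightarrow> int" where
  "sp_apply w i = sgn i * (0 # w) ! nat \<bar>i\<bar>"

definition involutionsB :: "nat \<Rightarrow> int list set" where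
  "involutionsB n =
     {w \<in> signed_perms n. \<forall>i. \<bar>i\<bar> \<le> int n \<longrightarrow> sp_apply w (sp_apply w i) = i}"

definition desB :: "int list \<Rightarrow> nat" where
  "desB w = card {i. i < length w \<and> (0 # w) ! i > (0 # w) ! (i + 1)}"

definition fixB :: "int list \<Rightarrow> nat" where
  "fixB w = card {i \<in> {1..int (length w)}. \<bar>sp_apply w i\<bar> = i}"

definition JB :: "nat \<Rightarrow> rat poly" where
  "JB n = (\<Sum>w | w \<in> involutionsB n \<and> fixB w = 0. monom 1 (desB w))"

text \<open>The identity \<open>J\<^sub>2\<^sub>j(t) = (1 + t)\<^sup>2\<^sup>j P\<^sub>j(t / (1 + t)\<^sup>2)\<close> is read in \<open>\<rat>[[t]]\<close>, where
  \<open>1 + t\<close> is a unit.\<close>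

definition gamma_poly :: "nat \<Rightarrow> rat poly" where
  "gamma_poly j = (THE p. degree p \<le> j \<and>
     fps_of_poly (JB (2 * j)) =
       (1 + fps_X) ^ (2 * j) * poly (map_poly fps_const p) (fps_X / (1 + fps_X)\<^sup>2))"

text \<open>\<open>D_coeff j s\<close> is \<open>D\<^sub>2\<^sub>j\<^sub>,\<^sub>s\<close>; the second index is an integer because negative values occur.\<close>

definition D_coeff :: "nat \<Rightarrow> int \<Rightarrow> rat" where
  "D_coeff j s = (if 0 \<le> s \<and> s \<le> int j then coeff (gamma_poly j) (nat s) else 0)"

text \<open>The generating function lives in \<open>\<rat>[[x]][[W]]\<close>: \<open>W\<close> is the outer variable, and
  \<open>1 + 4 x W\<close> is a unit because its constant term in \<open>W\<close> is \<open>1\<close>.\<close>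

definition A_gf :: "nat \<Rightarrow> rat fps fps" where
  "A_gf j = (let x = fps_const fps_X; W = fps_X in
     (1 + 4 * x * W) ^ (2 * j) *
     poly (map_poly (\<lambda>c. fps_const (fps_const c)) (gamma_poly j))
       (x * (1 + 2 * W + 4 * x * W\<^sup>2) / (1 + 4 * x * W)\<^sup>2))"

definition A_coeff :: "nat \<Rightarrow> nat \<Rightarrow> nat \<Rightarrow> rat" where
  "A_coeff j k r = fps_nth (fps_nth (A_gf j) r) k"

end

theory Submission
  imports Defs
begin

text \<open>Negation \<open>w \<mapsto> -w\<close> preserves fixed-point-free involutions and exchanges descents with
  ascents (the position \<open>0\<close> included), so \<open>J\<^sub>2\<^sub>j\<close> is palindromic with centre \<open>j\<close>. Subtracting
  \<open>J\<^sub>2\<^sub>j(0) (1 + t)\<^sup>2\<^sup>j\<close> and dividing by \<open>t\<close> lowers \<open>j\<close> by one, which gives the existence of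
  \<open>P\<^sub>j\<close> of degree at most \<open>j\<close>. Hence the generating function of the \<open>A\<^sub>j\<^sub>,\<^sub>r\<close> is the sum over \<open>s \<le> j\<close> of
  \<open>D\<^sub>2\<^sub>j\<^sub>,\<^sub>s x\<^sup>s (1 + 4xW)\<^sup>2\<^sup>j\<^sup>-\<^sup>2\<^sup>s (1 + 2W + 4xW\<^sup>2)\<^sup>s\<close>, and the coefficient of \<open>W\<^sup>2\<close> is read off
  from each summand.\<close>

section \<open>Existence and uniqueness of gamma expansions\<close>

text \<open>The coefficient ring is kept general because the lemma serves both
  \<open>rat fps\<close> and \<open>rat fps fps\<close>, and the coefficients of the latter do not
  form a field. Inversion of \<open>g\<close> starts from \<open>inverse (fps_nth g 0)\<close>,
  hence the condition on \<open>inverse 1\<close>.\<close>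

lemma fps_times_divide_unit:
  fixes f g :: "'a :: {comm_ring_1, inverse} fps"
  assumes "fps_nth g 0 = 1" "inverse (1 :: 'a) = 1"
  shows "g * (f / g) = f"
proof -
  have "g * inverse g = 1"
    using fps_right_inverse[of g 1] assms by (simp add: fps_inverse_def)
  then show ?thesis
    using assms(1) by (simp add: fps_divide_unit mult.left_commute)
qed

lemma gamma_expansion_exists:
  fixes f :: "'a :: field_char_0 fps"
  assumes "\<And>i. i \<le> 2 * j \<Longrightarrow> fps_nth f i = fps_nth f (2 * j - i)"
    and "\<And>i. i > 2 * j \<Longrightarrow> fps_nth f i = 0"
  shows "\<exists>p. degree p \<le> j \<and>
    f = (1 + fps_X) ^ (2 * j) * poly (map_poly fps_const p) (fps_X / (1 + fps_X)\<^sup>2)"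
  using assms
proof (induction j arbitrary: f)
  case 0
  then have "f = fps_const (fps_nth f 0)"
    by (intro fps_ext) (metis bot_nat_0.not_eq_extremum fps_nth_fps_const mult_0_right)
  then show ?case
    by (intro exI[of _ "[:fps_nth f 0:]"]) (simp add: map_poly_pCons)
next
  case (Suc j)
  define c where "c = fps_nth f 0"
  define h where "h = f - fps_const c * (1 + fps_X) ^ (2 * Suc j)"
  define g where "g = fps_shift 1 h"
  have hnth: "fps_nth h i = fps_nth f i - c * of_nat ((2 * Suc j) choose i)" for i
    by (simp add: h_def fps_binomial_of_nat [symmetric] binomial_gbinomial
        del: power_Suc of_nat_Suc of_nat_mult mult_Suc_right)
  have hsym: "fps_nth h i = fps_nth h (2 * Suc j - i)" if "i \<le> 2 * Suc j" for i
    using Suc.prems(1)[OF that] binomial_symmetric[OF that] by (simp only: hnth)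
  have h0: "fps_nth h 0 = 0"
    by (simp add: hnth c_def)
  have hbig: "fps_nth h i = 0" if "i > 2 * Suc j" for i
    using Suc.prems(2)[OF that] that by (simp only: hnth binomial_eq_0)  simp
  have "h = fps_X * g"
    using h0 by (intro fps_ext) (auto simp: g_def)
  have "fps_nth g i = fps_nth g (2 * j - i)" if "i \<le> 2 * j" for i
    using hsym[of "Suc i"] that by (simp add: g_def Suc_diff_le)
  moreover have "fps_nth g i = 0" if "i > 2 * j" for i
  \<comment> \<open>The shift lowers the degree bound only to \<open>2 * j + 1\<close>. The one
    remaining coefficient is the top coefficient of \<open>h\<close>, which by symmetry equals its
    constant term 0.\<close>
  proof (cases "i = 2 * j + 1")
    case True
    then show ?thesis using hsym[of "2 * Suc j"] h0 by (simp add: g_def)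
  next
    case False
    then show ?thesis using hbig[of "Suc i"] that by (simp add: g_def)
  qed
  ultimately obtain q where q: "degree q \<le> j"
    "g = (1 + fps_X) ^ (2 * j) * poly (map_poly fps_const q) (fps_X / (1 + fps_X)\<^sup>2)"
    using Suc.IH[of g] by blast
  let ?Q = "poly (map_poly fps_const q) (fps_X / (1 + fps_X)\<^sup>2)"
  have u: "(1 + fps_X)\<^sup>2 * (fps_X / (1 + fps_X)\<^sup>2) = (fps_X :: 'a fps)"
    by (rule fps_times_divide_unit) (simp_all add: fps_power_zeroth)
  have "f = fps_const c * (1 + fps_X) ^ (2 * Suc j) + fps_X * g"
    using \<open>h = fps_X * g\<close> by (simp add: h_def algebra_simps)
  also have "\<dots> = fps_const c * (1 + fps_X) ^ (2 * Suc j)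
      + ((1 + fps_X)\<^sup>2 * (fps_X / (1 + fps_X)\<^sup>2)) * ((1 + fps_X) ^ (2 * j) * ?Q)"
    by (simp only: u q(2))
  \<comment> \<open>Writing \<open>fps_X\<close> as \<open>(1 + fps_X)\<^sup>2\<close> times the
    evaluation point raises the exponent from \<open>2 * j\<close> to \<open>2 * Suc j\<close>; the
    factor left over turns \<open>q\<close> into \<open>pCons c q\<close>.\<close>
  also have "\<dots> = (1 + fps_X) ^ (2 * Suc j) * (fps_const c + (fps_X / (1 + fps_X)\<^sup>2) * ?Q)"
    by (simp add: algebra_simps power2_eq_square)
  also have "fps_const c + (fps_X / (1 + fps_X)\<^sup>2) * ?Q =
      poly (map_poly fps_const (pCons c q)) (fps_X / (1 + fps_X)\<^sup>2)"
    by (simp add: map_poly_pCons)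
  finally show ?case
    using q(1) by (intro exI[of _ "pCons c q"]) auto
qed

text \<open>This gives uniqueness. As \<open>u\<close> has no constant term, the constant term of
  the value is the lowest coefficient of \<open>p\<close>; once that is 0, the nonzero factor
  \<open>u\<close> cancels in the integral domain of power series.\<close>

lemma poly_fps_const_eq_0_iff:
  fixes p :: "'a :: idom poly"
  assumes "fps_nth u 0 = 0" "u \<noteq> 0"
  shows "poly (map_poly fps_const p) u = 0 \<longleftrightarrow> p = 0"
proof
  show "poly (map_poly fps_const p) u = 0 \<Longrightarrow> p = 0"
  proof (induction p)
    case (pCons a p)
    have eq: "fps_const a + u * poly (map_poly fps_const p) u = 0"
      using pCons.prems pCons.hyps by (simp add: map_poly_pCons)
    from arg_cong[OF this, of "\<lambda>f. fps_nth f 0"] assms(1) have "a = 0"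
      by simp
    then show ?case
      using eq assms(2) pCons.IH by simp
  qed simp
qed simp

section \<open>Negation of signed permutations and palindromicity\<close>

lemma signed_perms_iff:
  "w \<in> signed_perms n \<longleftrightarrow> set (map abs w) = {1..int n} \<and> distinct (map abs w)"
  by (simp add: signed_perms_def permutations_of_set_def)

lemma signed_perms_uminus:
  "map uminus w \<in> signed_perms n \<longleftrightarrow> w \<in> signed_perms n"
  by (simp add: signed_perms_def comp_def)

lemma signed_perms_length: "w \<in> signed_perms n \<Longrightarrow> length w = n"
  using length_finite_permutations_of_set[of "map abs w" "{1..int n}"]
  by (auto simp: signed_perms_def)

text \<open>The absolute values, with the leading 0 included, are pairwise distinct. Hence every
  position is a strict descent or a strict ascent, and negation complements the descent set.\<close>

lemma signed_perms_nth_distinct: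
  assumes "w \<in> signed_perms n" "i < n"
  shows "(0 # w) ! i \<noteq> (0 # w) ! Suc i"
proof -
  have w: "set (map abs w) = {1..int n}" "distinct (map abs w)"
    using assms(1) by (simp_all only: signed_perms_iff)
  have "distinct (0 # map abs w)"
    using w by auto
  then have "distinct (map abs (0 # w))" by simp
  then have "map abs (0 # w) ! i \<noteq> map abs (0 # w) ! Suc i"
    using assms signed_perms_length by (subst nth_eq_iff_index_eq) auto
  then show ?thesis
    using assms signed_perms_length[OF assms(1)] by (auto simp: nth_Cons')
qed

lemma nth_zero_Cons_uminus:
  fixes w :: "int list"
  assumes "i \<le> length w"
  shows "(0 # map uminus w) ! i = - ((0 # w) ! i)"
  using assms by (cases i) auto

lemma desB_uminus:
  assumes "w \<in> signed_perms n"
  shows "desB (map uminus w) + desB w = n"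
proof -
  have n: "length w = n" using assms by (rule signed_perms_length)
  let ?D = "{i. i < n \<and> (0 # w) ! i > (0 # w) ! (i + 1)}"
  have "{i. i < n \<and> (0 # map uminus w) ! i > (0 # map uminus w) ! (i + 1)} = {..<n} - ?D"
    using signed_perms_nth_distinct[OF assms] n by (fastforce simp: nth_zero_Cons_uminus simp del: nth_Cons_Suc)
  moreover have "card ({..<n} - ?D) = n - card ?D"
    by (subst card_Diff_subset) auto
  moreover have "card ?D \<le> card {..<n}"
    by (rule card_mono) auto
  ultimately show ?thesis
    by (simp add: desB_def n)
qed

lemma sp_apply_uminus:
  assumes "\<bar>i\<bar> \<le> int (length w)"
  shows "sp_apply (map uminus w) i = - sp_apply w i"
  using assms by (simp add: sp_apply_def nth_zero_Cons_uminus)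

lemma sp_apply_arg_uminus: "sp_apply w (- i) = - sp_apply w i"
  by (simp add: sp_apply_def)

text \<open>\<open>sp_apply_uminus\<close> holds for arguments in range; this bound allows its
  second use, at \<open>sp_apply w i\<close>, when \<open>map uminus w\<close> is squared.\<close>

lemma abs_sp_apply_le:
  assumes "w \<in> signed_perms n" "\<bar>i\<bar> \<le> int n"
  shows "\<bar>sp_apply w i\<bar> \<le> int n"
proof -
  have n: "length w = n" using assms(1) by (rule signed_perms_length)
  have w: "set (map abs w) = {1..int n}"
    using assms(1) by (simp only: signed_perms_iff)
  have "(0 # w) ! nat \<bar>i\<bar> \<in> set (0 # w)"
    by (rule nth_mem) (use n assms(2) in auto)
  moreover have "\<bar>x\<bar> \<le> int n" if "x \<in> set (0 # w)" for x
    using that w by (cases "x = 0") (auto simp: set_eq_iff image_iff)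
  ultimately show ?thesis
    by (auto simp: sp_apply_def abs_mult abs_sgn_eq)
qed

lemma involutionsB_uminus:
  assumes "w \<in> involutionsB n"
  shows "map uminus w \<in> involutionsB n"
proof -
  have w: "w \<in> signed_perms n" "\<And>i. \<bar>i\<bar> \<le> int n \<Longrightarrow> sp_apply w (sp_apply w i) = i"
    using assms by (auto simp: involutionsB_def)
  have n: "length w = n" using w(1) by (rule signed_perms_length)
  show ?thesis
    using w n abs_sp_apply_le[OF w(1)]
    by (auto simp: involutionsB_def signed_perms_uminus sp_apply_uminus sp_apply_arg_uminus)
qed

lemma fixB_uminus: "fixB (map uminus w) = fixB w"
  unfolding fixB_def by (rule arg_cong[of _ _ card]) (auto simp: sp_apply_uminus)

lemma finite_involutionsB: "finite (involutionsB n)"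
proof -
  have "involutionsB n \<subseteq> {w. set w \<subseteq> {-int n..int n} \<and> length w = n}"
  proof safe
    fix w x assume w: "w \<in> involutionsB n" and x: "x \<in> set w"
    then have "set (map abs w) = {1..int n}"
      by (simp add: involutionsB_def signed_perms_iff)
    with x have "\<bar>x\<bar> \<in> {1..int n}" by auto
    then show "x \<in> {-int n..int n}" by auto
  qed (auto simp: involutionsB_def dest: signed_perms_length)
  then show ?thesis
    by (rule finite_subset) (simp add: finite_lists_length_eq)
qed

lemma coeff_JB:
  "coeff (JB n) i = of_nat (card {w \<in> involutionsB n. fixB w = 0 \<and> desB w = i})"
proof -
  have "coeff (JB n) i = (\<Sum>w | w \<in> involutionsB n \<and> fixB w = 0. if desB w = i then 1 else 0)"
    by (simp add: JB_def coeff_sum)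
  also have "\<dots> = of_nat (card {w \<in> involutionsB n. fixB w = 0 \<and> desB w = i})"
    using finite_involutionsB[of n]
    by (simp add: sum.If_cases Int_def)
  finally show ?thesis .
qed

lemma desB_uminus_involutionsB: "w \<in> involutionsB n \<Longrightarrow> desB (map uminus w) + desB w = n"
  by (simp add: desB_uminus involutionsB_def)

lemma coeff_JB_palindromic:
  assumes "i \<le> n"
  shows "coeff (JB n) i = coeff (JB n) (n - i)"
proof -
  have "bij_betw (map uminus)
      {w \<in> involutionsB n. fixB w = 0 \<and> desB w = i}
      {w \<in> involutionsB n. fixB w = 0 \<and> desB w = n - i}"
    using assms
    by (intro bij_betwI[where g = "map uminus"])
      (auto simp: involutionsB_uminus fixB_uminus comp_def dest: desB_uminus_involutionsB)
  then show ?thesis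
    by (simp add: coeff_JB bij_betw_same_card)
qed

lemma coeff_JB_eq_0: "i > n \<Longrightarrow> coeff (JB n) i = 0"
  by (auto simp: coeff_JB card_eq_0_iff dest: desB_uminus_involutionsB)

text \<open>\<open>gamma_poly\<close> is a definite description, so its existence and uniqueness are
  settled here. The bound lets sums run over \<open>s \<le> j\<close>, the range on which
  \<open>D_coeff\<close> reads coefficients.\<close>

lemma degree_gamma_poly: "degree (gamma_poly j) \<le> j"
proof -
  let ?u = "fps_X / (1 + fps_X)\<^sup>2 :: rat fps"
  let ?P = "\<lambda>p. degree p \<le> j \<and>
       fps_of_poly (JB (2 * j)) = (1 + fps_X) ^ (2 * j) * poly (map_poly fps_const p) ?u"
  have unit: "(1 + fps_X)\<^sup>2 * ?u = fps_X"
    by (rule fps_times_divide_unit) (simp_all add: fps_power_zeroth)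
  have u0: "?u \<noteq> 0"
    using unit by (metis fps_X_neq_zero mult_zero_right)
  have u_nth: "fps_nth ?u 0 = 0"
    using arg_cong[OF unit, of "\<lambda>f. fps_nth f 0"] by simp
  have "\<exists>p. ?P p"
    by (rule gamma_expansion_exists)
      (simp_all only: fps_of_poly_nth coeff_JB_palindromic [symmetric] coeff_JB_eq_0)
  moreover have "p = q" if "?P p" "?P q" for p q
  proof -
    have "(1 + fps_X :: rat fps) ^ (2 * j) \<noteq> 0"
      by simp
    with that have "poly (map_poly fps_const p) ?u = poly (map_poly fps_const q) ?u"
      by (metis mult_cancel_left)
    moreover have "map_poly fps_const (p - q) = map_poly fps_const p - map_poly fps_const q"
      by (intro poly_eqI) (simp add: coeff_map_poly)
    ultimately have "poly (map_poly fps_const (p - q)) ?u = 0"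
      by simp
    then show "p = q"
      using poly_fps_const_eq_0_iff[OF u_nth u0] by auto
  qed
  ultimately have "\<exists>!p. ?P p" by blast
  from theI'[OF this] show ?thesis
    unfolding gamma_poly_def by blast
qed

section \<open>The coefficient of \<open>W\<^sup>2\<close> in each summand\<close>

text \<open>In a product of \<open>n\<close> copies of \<open>f\<close>, degree 2 arises either from
  one factor giving its quadratic term or from two factors giving their linear terms.\<close>

lemma fps_power_nth_le_2:
  fixes f :: "'a :: comm_ring_1 fps"
  assumes "fps_nth f 0 = 1"
  shows "fps_nth (f ^ n) 0 = 1" "fps_nth (f ^ n) 1 = of_nat n * fps_nth f 1"
    "fps_nth (f ^ n) 2 = of_nat n * fps_nth f 2 + of_nat (n choose 2) * (fps_nth f 1)\<^sup>2"
proof -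
  show 0: "fps_nth (f ^ n) 0 = 1" for n
    using assms by (induction n) auto
  show 1: "fps_nth (f ^ n) 1 = of_nat n * fps_nth f 1" for n
    using assms 0 by (induction n) (auto simp: fps_mult_nth algebra_simps)
  show "fps_nth (f ^ n) 2 = of_nat n * fps_nth f 2 + of_nat (n choose 2) * (fps_nth f 1)\<^sup>2"
  proof (induction n)
    case (Suc n)
    have "fps_nth (f ^ Suc n) 2 = fps_nth (f ^ n) 2 + fps_nth f 1 * fps_nth (f ^ n) 1 + fps_nth f 2"
      using assms 0[of n] by (simp add: fps_mult_nth numeral_2_eq_2)
    also have "\<dots> = of_nat (Suc n) * fps_nth f 2 + of_nat (Suc n choose 2) * (fps_nth f 1)\<^sup>2"
      unfolding 1 Suc by (simp add: numeral_2_eq_2 algebra_simps)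
    finally show ?case .
  qed (simp add: numeral_2_eq_2)
qed

lemma of_nat_choose_two:
  "of_nat (n choose 2) = (of_nat n * (of_nat n - 1) / 2 :: 'a :: field_char_0)"
  by (induction n) (simp_all add: numeral_2_eq_2 field_simps)

lemma A_gf_monomial_nth_2:
  fixes x W :: "rat fps fps"
  defines "x \<equiv> fps_const fps_X" and "W \<equiv> fps_X"
  assumes "s \<le> j"
  shows "fps_nth ((1 + 4 * x * W) ^ (2 * j) *
      (x * (1 + 2 * W + 4 * x * W\<^sup>2) / (1 + 4 * x * W)\<^sup>2) ^ s) 2 =
    fps_X ^ s * (of_nat (4 * (s choose 2)) + of_nat (4 * s * (4 * (j - s) + 1)) * fps_X
      + of_nat (16 * ((2 * (j - s)) choose 2)) * fps_X\<^sup>2)"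
proof -
  obtain m where j: "j = s + m"
    using \<open>s \<le> j\<close> le_Suc_ex by blast
  define D where "D = 1 + 4 * x * W"
  define N where "N = 1 + 2 * W + 4 * x * W\<^sup>2"
  define y where "y = x * N / D\<^sup>2"
  have four: "4 * x = fps_const (4 * fps_X)"
    by (simp add: x_def numeral_fps_const)
  have D: "fps_nth D 0 = 1" "fps_nth D 1 = 4 * fps_X" "fps_nth D 2 = 0"
    by (simp_all add: D_def four W_def)
  have N: "fps_nth N 0 = 1" "fps_nth N 1 = 2" "fps_nth N 2 = 4 * fps_X"
    by (simp_all add: N_def four W_def fps_numeral_nth)
  have Dy: "D\<^sup>2 * y = x * N"
    unfolding y_def by (rule fps_times_divide_unit) (simp_all add: fps_power_zeroth D)
  \<comment> \<open>Since \<open>s \<le> j\<close>, the power of \<open>D\<close> can spare one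
    \<open>D\<^sup>2\<close> for each \<open>y\<close>, which clears all denominators.\<close>
  have "D ^ (2 * j) * y ^ s = D ^ (2 * (j - s)) * (D\<^sup>2 * y) ^ s"
    using \<open>s \<le> j\<close>
    by (simp add: power_mult_distrib flip: power_mult power_add mult.assoc distrib_left)
  also have "\<dots> = fps_const (fps_X ^ s) * (D ^ (2 * (j - s)) * N ^ s)"
    by (simp add: Dy power_mult_distrib x_def)
  finally have "fps_nth (D ^ (2 * j) * y ^ s) 2 =
      fps_X ^ s * fps_nth (D ^ (2 * (j - s)) * N ^ s) 2"
    by simp
  also have "fps_nth (D ^ (2 * (j - s)) * N ^ s) 2 =
      fps_nth (D ^ (2 * (j - s))) 0 * fps_nth (N ^ s) 2 +
      fps_nth (D ^ (2 * (j - s))) 1 * fps_nth (N ^ s) 1 +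
      fps_nth (D ^ (2 * (j - s))) 2 * fps_nth (N ^ s) 0"
    by (simp add: fps_mult_nth numeral_2_eq_2)
  \<comment> \<open>With \<open>m = j - s\<close>, the power of \<open>N\<close> gives
    \<open>4 * (s choose 2) + 4 * s * x\<close>, the product of the linear terms gives
    \<open>16 * s * m * x\<close>, and the power of \<open>D\<close> gives
    \<open>16 * ((2 * m) choose 2) * x\<^sup>2\<close>.\<close>
  also have "\<dots> = of_nat (4 * (s choose 2)) + of_nat (4 * s * (4 * (j - s) + 1)) * fps_X
      + of_nat (16 * ((2 * (j - s)) choose 2)) * fps_X\<^sup>2"
    unfolding fps_power_nth_le_2[OF D(1)] fps_power_nth_le_2[OF N(1)] D N
    by (simp add: j algebra_simps power2_eq_square)
  finally show ?thesis
    unfolding y_def D_def N_def .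
qed

section \<open>Extraction of the power of \<open>x\<close> and passage to
  \<open>D_coeff\<close>\<close>

lemma fps_nth_X_power_times_quadratic:
  fixes a b c :: nat
  shows "fps_nth (fps_X ^ s * (of_nat a + of_nat b * fps_X + of_nat c * fps_X\<^sup>2)) k =
    (if k = s then of_nat a else 0) + (if k = s + 1 then of_nat b else 0)
      + (if k = s + 2 then of_nat c else (0 :: 'a :: comm_ring_1))"
  by (auto simp: fps_X_power_mult_nth fps_of_nat [symmetric])

text \<open>Only \<open>s = k - d\<close> survives. If \<open>k < d\<close> or
  \<open>k - d > j\<close>, no index survives, and the default value 0 of \<open>D_coeff\<close>
  matches.\<close>

lemma sum_gamma_poly_shift:
  "(\<Sum>s\<le>j. coeff (gamma_poly j) s * (if k = s + d then c s else 0)) =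
    D_coeff j (int k - int d) * c (k - d)"
proof (cases "d \<le> k")
  case True
  then have "(\<Sum>s\<le>j. coeff (gamma_poly j) s * (if k = s + d then c s else 0)) =
      (\<Sum>s\<le>j. if s = k - d then coeff (gamma_poly j) s * c s else 0)"
    by (intro sum.cong) auto
  also have "\<dots> = D_coeff j (int k - int d) * c (k - d)"
    using True by (auto simp: D_coeff_def nat_diff_distrib)
  finally show ?thesis .
qed (auto simp: D_coeff_def intro!: sum.neutral)

text \<open>The form \<open>s + 0\<close> makes all three cases instances of
  \<open>sum_gamma_poly_shift\<close>, with \<open>d\<close> equal to 0, 1 and 2.\<close>

lemma A_coeff_2_sum:
  "A_coeff j k 2 = (\<Sum>s\<le>j. coeff (gamma_poly j) s *
    ((if k = s + 0 then of_nat (4 * (s choose 2)) else 0)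
    + (if k = s + 1 then of_nat (4 * s * (4 * (j - s) + 1)) else 0)
    + (if k = s + 2 then of_nat (16 * ((2 * (j - s)) choose 2)) else 0)))"
proof -
  let ?D = "1 + 4 * fps_const fps_X * fps_X :: rat fps fps"
  let ?y = "fps_const fps_X * (1 + 2 * fps_X + 4 * fps_const fps_X * fps_X\<^sup>2) / ?D\<^sup>2"
  let ?c = "coeff (gamma_poly j)"
  let ?m = "\<lambda>c. fps_const (fps_const c) :: rat fps fps"
  have "poly (map_poly ?m (gamma_poly j)) ?y = (\<Sum>s\<le>degree (gamma_poly j). ?m (?c s) * ?y ^ s)"
    by (simp add: poly_altdef degree_map_poly coeff_map_poly)
  also have "\<dots> = (\<Sum>s\<le>j. ?m (?c s) * ?y ^ s)"
    using degree_gamma_poly[of j]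
    by (intro sum.mono_neutral_left) (auto simp: coeff_eq_0)
  finally have "A_gf j = (\<Sum>s\<le>j. ?m (?c s) * (?D ^ (2 * j) * ?y ^ s))"
    by (simp add: A_gf_def Let_def sum_distrib_left mult.left_commute)
  then have "A_coeff j k 2 = (\<Sum>s\<le>j. ?c s * fps_nth (fps_nth (?D ^ (2 * j) * ?y ^ s) 2) k)"
    by (simp add: A_coeff_def fps_sum_nth)
  also have "\<dots> = (\<Sum>s\<le>j. ?c s *
    ((if k = s + 0 then of_nat (4 * (s choose 2)) else 0)
    + (if k = s + 1 then of_nat (4 * s * (4 * (j - s) + 1)) else 0)
    + (if k = s + 2 then of_nat (16 * ((2 * (j - s)) choose 2)) else 0)))"
    by (intro sum.cong refl, subst A_gf_monomial_nth_2, simp,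
        simp only: fps_nth_X_power_times_quadratic add_0_right)
  finally show ?thesis .
qed

theorem corollary6p2:
  fixes j k :: nat
  shows "A_coeff j k 2 =
      2 * of_nat k * (of_nat k - 1) * D_coeff j (int k)
    + 4 * (of_nat k - 1) * (4 * of_nat j - 4 * of_nat k + 5) * D_coeff j (int k - 1)
    + 16 * (of_nat j - of_nat k + 2) * (2 * of_nat j - 2 * of_nat k + 3) * D_coeff j (int k - 2)"
proof -
  have "A_coeff j k 2 =
      D_coeff j (int k - int 0) * of_nat (4 * ((k - 0) choose 2))
    + D_coeff j (int k - int 1) * of_nat (4 * (k - 1) * (4 * (j - (k - 1)) + 1))
    + D_coeff j (int k - int 2) * of_nat (16 * ((2 * (j - (k - 2))) choose 2))"
    unfolding A_coeff_2_sum distrib_left sum.distrib sum_gamma_poly_shift ..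
  then have "A_coeff j k 2 =
      D_coeff j (int k) * of_nat (4 * (k choose 2))
    + D_coeff j (int k - 1) * of_nat (4 * (k - 1) * (4 * (j - (k - 1)) + 1))
    + D_coeff j (int k - 2) * of_nat (16 * ((2 * (j - (k - 2))) choose 2))"
    by simp
  moreover have "D_coeff j (int k) * of_nat (4 * (k choose 2)) =
      2 * of_nat k * (of_nat k - 1) * D_coeff j (int k)"
    by (simp add: of_nat_choose_two)
  moreover have "D_coeff j (int k - 1) * of_nat (4 * (k - 1) * (4 * (j - (k - 1)) + 1)) =
      4 * (of_nat k - 1) * (4 * of_nat j - 4 * of_nat k + 5) * D_coeff j (int k - 1)"
  \<comment> \<open>In this range the truncated subtractions are exact; outside it
    \<open>D_coeff\<close> vanishes on both sides. The same split handles the last term.\<close>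
  proof (cases "1 \<le> k \<and> k - 1 \<le> j")
    case True
    then obtain i m where "k = i + 1" "j = i + m"
      by (metis le_add_diff_inverse le_add_diff_inverse2)
    then show ?thesis by (simp add: algebra_simps)
  next
    case False
    then show ?thesis by (auto simp: D_coeff_def)
  qed
  moreover have "D_coeff j (int k - 2) * of_nat (16 * ((2 * (j - (k - 2))) choose 2)) =
      16 * (of_nat j - of_nat k + 2) * (2 * of_nat j - 2 * of_nat k + 3) * D_coeff j (int k - 2)"
  proof (cases "2 \<le> k \<and> k - 2 \<le> j")
    case True
    then obtain i m where "k = i + 2" "j = i + m"
      by (metis le_add_diff_inverse le_add_diff_inverse2)
    \<comment> \<open>Here \<open>m\<close> is \<open>j - k + 2\<close>, and
      \<open>(2 * m) choose 2\<close> is \<open>m * (2 * m - 1)\<close>, whose second factor is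
      \<open>2 * j - 2 * k + 3\<close>.\<close>
    then show ?thesis by (simp add: of_nat_choose_two field_simps)
  next
    case False
    then show ?thesis by (auto simp: D_coeff_def)
  qed
  ultimately show ?thesis by (simp only:)
qed

end
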